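(* Let $\mathcal{W}$ be a standard sequence of generating words with bounded spacers such that $X_{\mathcal{W}}$ is aperiodic. Let $\boldsymbol{\tau}'_{\mathcal{W}}$ be the shifted directive sequence and $U_{\mathcal{W}} = \tau_0(X_{\boldsymbol{\tau}'_{\mathcal{W}}}) \subseteq X_{\mathcal{W}}$. Then the induced system $(U_{\mathcal{W}}, S_{U_{\mathcal{W}}})$ of $(X_{\mathcal{W}}, S)$ on $U_{\mathcal{W}}$ is mean equicontinuous.
   Context: $S$ is the shift; a subshift is aperiodic if it is nonempty and contains no shift-periodic point. Ferenczi subshifts. Given nonnegative integers $(q_n)_{n \ge 0}$ (cutting parameters) and $(a_{n,i} : n \ge 0, 0 \le i < q_n)$ (spacer parameters), the sequence of generating words $\mathcal{W} = (w_n)_{n \ge 0}$ over $\{0,1\}$ is $w_0 = 0$, $w_{n+1} = w_n 1^{a_{n,0}} w_n 1^{a_{n,1}} \cdots w_n 1^{a_{n,q_n-1}} w_n$. $X_{\mathcal{W}}$ is the set of $x \in \{0,1\}^{\mathbb{Z}}$ every finite factor of which is a factor of some $w_n$. $\mathcal{W}$ is standard if $q_n \ge 2$ for all $n$. If the spacers are bounded, $(X_{\mathcal{W}},S)$ is minimal. Directive sequences. $\mathcal{A}_0 = \{0,1\}$, $\mathcal{A}_n = \{a_{N,i} : N \ge n-1, 0 \le i < q_N\}$ for $n \ge 1$. $\boldsymbol{\tau}_{\mathcal{W}} = (\tau_n : \mathcal{A}_{n+1}^* \to \mathcal{A}_n^* )_{n\ge 0}$ consists of the morphisms $\tau_0(a)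 = 01^a$ and, for $n \ge 1$, $\tau_n(a) = a_{n-1,1} \cdots a_{n-1,q_{n-1}-1}\, a\, a_{n-1,0}$. The shifted sequence is $\boldsymbol{\tau}'_{\mathcal{W}} = (\tau_{n+1} : \mathcal{A}_{n+2}^* \to \mathcal{A}_{n+1}^* )_{n \ge 0}$, and $X_{\boldsymbol{\tau}'_{\mathcal{W}}}$ is the set of $x \in \mathcal{A}_1^{\mathbb{Z}}$ all of whose finite factors occur in $\tau_1 \circ \cdots \circ \tau_{N-1}(a)$ for some $N > 1$ and $a \in \mathcal{A}_N$. A morphism acts on two-sided sequences by concatenation (the image of the letter $x_0$ starting at coordinate $0$). The set $U_{\mathcal{W}}$ is clopen in $X_{\mathcal{W}}$. Induced system. For a minimal Cantor system $(X,T)$ and a nonempty clopen $U \subseteq X$, $T_U(x) = T^{r_U(x)}x$ for $x \in U$, where $r_U(x) = \inf\{n > 0 : T^n x \in U\}$. A topological dynamical system $(X,T)$ (homeomorphism $T$ of a compact metric space with metric $d$) is mean equicontinuous if for every $\varepsilon>0$ there is $\delta>0$ such that $d(x,y) \le \delta$ implies $\limsup_{n\to+\infty} \frac1n \sum_{k=0}^{n-1} d(T^k x, T^k y) \le \varepsilon$. *)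

theory Defs
  imports "HOL-Analysis.Analysis" "HOL-Library.Sublist"
begin

text \<open>
  Letters are natural numbers and two-sided sequences are functions from the integers.
  The type class topology on \<^typ>\<open>int \<Rightarrow> nat\<close> is the product topology with discrete factors.
\<close>

definition shift :: "(int \<Rightarrow> 'a) \<Rightarrow> (int \<Rightarrow> 'a)" where
  "shift x = (\<lambda>k. x (k + 1))"

definition aperiodic :: "(int \<Rightarrow> 'a) set \<Rightarrow> bool" where
  "aperiodic X \<longleftrightarrow> X \<noteq> {} \<and> (\<forall>x\<in>X. \<forall>p>0. (shift ^^ p) x \<noteq> x)"


section \<open>Ferenczi subshifts\<close>

text \<open>
  Cutting parameters \<open>q\<close> and spacer parameters \<open>a\<close>; only the values \<open>a n i\<close> with \<open>i < q n\<close>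
  are meaningful.
\<close>

primrec gen_word :: "(nat \<Rightarrow> nat) \<Rightarrow> (nat \<Rightarrow> nat \<Rightarrow> nat) \<Rightarrow> nat \<Rightarrow> nat list" where
  "gen_word q a 0 = [0]"
| "gen_word q a (Suc n) =
     concat (map (\<lambda>i. gen_word q a n @ replicate (a n i) 1) [0..<q n]) @ gen_word q a n"

definition standard :: "(nat \<Rightarrow> nat) \<Rightarrow> bool" where
  "standard q \<longleftrightarrow> (\<forall>n. q n \<ge> 2)"

definition bounded_spacers :: "(nat \<Rightarrow> nat) \<Rightarrow> (nat \<Rightarrow> nat \<Rightarrow> nat) \<Rightarrow> bool" where
  "bounded_spacers q a \<longleftrightarrow> (\<exists>B. \<forall>n. \<forall>i<q n. a n i \<le> B)"

definition ferenczi_subshift :: "(nat \<Rightarrow> nat) \<Rightarrow> (nat \<Rightarrow> nat \<Rightarrow> nat) \<Rightarrow> (int \<Rightarrow> nat) set" where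
  "ferenczi_subshift q a =
     {x. range x \<subseteq> {0, 1} \<and> (\<forall>i j. \<exists>n. sublist (map x [i..j]) (gen_word q a n))}"


section \<open>Morphisms and directive sequences\<close>

text \<open>A morphism of free monoids is given by the images of the letters.\<close>

definition morph_word :: "('a \<Rightarrow> 'b list) \<Rightarrow> 'a list \<Rightarrow> 'b list" where
  "morph_word \<sigma> u = concat (map \<sigma> u)"

text \<open>
  \<open>morph_pos \<sigma> x k\<close> is the coordinate at which the block \<open>\<sigma> (x k)\<close> starts in the image of \<open>x\<close>,
  normalised by \<open>morph_pos \<sigma> x 0 = 0\<close>; one of the two sums is always empty.
\<close>

definition morph_pos :: "('a \<Rightarrow> 'b list) \<Rightarrow> (int \<Rightarrow> 'a) \<Rightarrow> int \<Rightarrow> int" where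
  "morph_pos \<sigma> x k =
     (\<Sum>i\<in>{0..<k}. int (length (\<sigma> (x i)))) - (\<Sum>i\<in>{k..<0}. int (length (\<sigma> (x i))))"

text \<open>
  The action on two-sided sequences. For nonerasing \<open>\<sigma>\<close> the index \<open>k\<close> of the block
  covering coordinate \<open>m\<close> exists and is unique.
\<close>

definition morph_seq :: "('a \<Rightarrow> 'b list) \<Rightarrow> (int \<Rightarrow> 'a) \<Rightarrow> (int \<Rightarrow> 'b)" where
  "morph_seq \<sigma> x = (\<lambda>m.
     let k = (THE k. morph_pos \<sigma> x k \<le> m \<and> m < morph_pos \<sigma> x (k + 1))
     in \<sigma> (x k) ! nat (m - morph_pos \<sigma> x k))"

text \<open>\<open>morph_comp \<sigma> N\<close> is the composition \<open>\<sigma> 0 \<circ> \<sigma> 1 \<circ> \<dots> \<circ> \<sigma> (N - 1)\<close>.\<close>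

primrec morph_comp :: "(nat \<Rightarrow> 'a \<Rightarrow> 'a list) \<Rightarrow> nat \<Rightarrow> 'a list \<Rightarrow> 'a list" where
  "morph_comp \<sigma> 0 = id"
| "morph_comp \<sigma> (Suc N) = morph_comp \<sigma> N \<circ> morph_word (\<sigma> N)"

text \<open>The subshift of a directive sequence \<open>\<sigma> n : (A (n + 1))\<^sup>* \<rightarrow> (A n)\<^sup>*\<close>.\<close>

definition directive_subshift ::
    "(nat \<Rightarrow> 'a set) \<Rightarrow> (nat \<Rightarrow> 'a \<Rightarrow> 'a list) \<Rightarrow> (int \<Rightarrow> 'a) set" where
  "directive_subshift A \<sigma> =
     {x. range x \<subseteq> A 0 \<and>
         (\<forall>i j. \<exists>N>0. \<exists>b\<in>A N. sublist (map x [i..j]) (morph_comp \<sigma> N [b]))}"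

fun alphabet :: "(nat \<Rightarrow> nat) \<Rightarrow> (nat \<Rightarrow> nat \<Rightarrow> nat) \<Rightarrow> nat \<Rightarrow> nat set" where
  "alphabet q a 0 = {0, 1}"
| "alphabet q a (Suc n) = {a N i | N i. N \<ge> n \<and> i < q N}"

fun tau :: "(nat \<Rightarrow> nat) \<Rightarrow> (nat \<Rightarrow> nat \<Rightarrow> nat) \<Rightarrow> nat \<Rightarrow> nat \<Rightarrow> nat list" where
  "tau q a 0 b = 0 # replicate b 1"
| "tau q a (Suc n) b = map (a n) [1..<q n] @ [b, a n 0]"

definition shifted_subshift :: "(nat \<Rightarrow> nat) \<Rightarrow> (nat \<Rightarrow> nat \<Rightarrow> nat) \<Rightarrow> (int \<Rightarrow> nat) set" where
  "shifted_subshift q a =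
     directive_subshift (\<lambda>n. alphabet q a (Suc n)) (\<lambda>n. tau q a (Suc n))"

definition ferenczi_base :: "(nat \<Rightarrow> nat) \<Rightarrow> (nat \<Rightarrow> nat \<Rightarrow> nat) \<Rightarrow> (int \<Rightarrow> nat) set" where
  "ferenczi_base q a = morph_seq (tau q a 0) ` shifted_subshift q a"


section \<open>Induced systems and mean equicontinuity\<close>

definition return_time :: "('a \<Rightarrow> 'a) \<Rightarrow> 'a set \<Rightarrow> 'a \<Rightarrow> nat" where
  "return_time T U x = Inf {n. n > 0 \<and> (T ^^ n) x \<in> U}"

definition induced_map :: "('a \<Rightarrow> 'a) \<Rightarrow> 'a set \<Rightarrow> 'a \<Rightarrow> 'a" where
  "induced_map T U x = (T ^^ return_time T U x) x"

definition top_dyn_system :: "'a set \<Rightarrow> ('a \<Rightarrow> 'a \<Rightarrow> real) \<Rightarrow> ('a \<Rightarrow> 'a) \<Rightarrow> bool" where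
  "top_dyn_system X d T \<longleftrightarrow>
     Metric_space X d \<and>
     compact_space (Metric_space.mtopology X d) \<and>
     homeomorphic_map (Metric_space.mtopology X d) (Metric_space.mtopology X d) T"

definition mean_equicontinuous :: "'a set \<Rightarrow> ('a \<Rightarrow> 'a \<Rightarrow> real) \<Rightarrow> ('a \<Rightarrow> 'a) \<Rightarrow> bool" where
  "mean_equicontinuous X d T \<longleftrightarrow>
     top_dyn_system X d T \<and>
     (\<forall>\<epsilon>>0. \<exists>\<delta>>0. \<forall>x\<in>X. \<forall>y\<in>X. d x y \<le> \<delta> \<longrightarrow>
        limsup (\<lambda>n. ereal ((1 / real n) * (\<Sum>k<n. d ((T ^^ k) x) ((T ^^ k) y)))) \<le> ereal \<epsilon>)"

text \<open>\<open>d\<close> is a metric on \<open>X\<close> inducing the subspace topology.\<close>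

definition compatible_metric :: "'a::topological_space set \<Rightarrow> ('a \<Rightarrow> 'a \<Rightarrow> real) \<Rightarrow> bool" where
  "compatible_metric X d \<longleftrightarrow>
     Metric_space X d \<and> Metric_space.mtopology X d = top_of_set X"

end

(*
  For x in the subshift X of the shifted directive sequence and every level N there is a period
  p > N such that x is constant on all residue classes modulo p except one: the words
  tau_1 ... tau_N (b) all have the form A b B, with A, B independent of b and p = |A b B|.
  If x and y agree on a window of length p, then they agree on every residue class that is
  exceptional for neither of them, hence off a set of density at most 2/p; no recognizability
  is required. Now tau_0 is injective, and thus a homeomorphism of X onto its image U, and it
  conjugates the shift on X to the induced map on U, because the return time of tau_0 (x) to U
  is the length of tau_0 (x_0). Uniform continuity of tau_0 and of its inverse transfers the
  density estimate to any compatible metric on U.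
*)

theory Submission
  imports Defs
begin

section \<open>Compositions of morphisms, and concatenations of blocks with one free letter\<close>

lemma morph_comp_append: "morph_comp \<sigma> N (u @ v) = morph_comp \<sigma> N u @ morph_comp \<sigma> N v"
  by (induction N arbitrary: u v) (simp_all add: morph_word_def)

lemma morph_comp_Nil: "morph_comp \<sigma> N [] = []"
  by (induction N) (simp_all add: morph_word_def)

lemma morph_comp_concat: "morph_comp \<sigma> N v = concat (map (\<lambda>b. morph_comp \<sigma> N [b]) v)"
proof (induction v)
  case (Cons b v)
  then show ?case using morph_comp_append[of \<sigma> N "[b]" v] by simp
qed (simp add: morph_comp_Nil)

text \<open>New morphisms are composed on the inside, so the first \<open>N\<close> of them stay
  outermost and can be split off.\<close>

lemma morph_comp_factor:
  assumes "N \<le> M"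
  shows "\<exists>v. morph_comp \<sigma> M w = morph_comp \<sigma> N v"
  using assms
proof (induction M arbitrary: w rule: dec_induct)
  case (step M)
  then show ?case by simp
qed blast

text \<open>This is a periodic skeleton of period \<open>p\<close> with at most one undetermined
  residue class, as in the construction of Toeplitz sequences. For \<open>p > 0\<close>, a value of
  \<open>h\<close> outside \<open>{0..<p}\<close> excludes no class and makes \<open>x\<close>
  periodic.\<close>

definition constant_off_class :: "int \<Rightarrow> int \<Rightarrow> (int \<Rightarrow> 'a) \<Rightarrow> bool" where
  "constant_off_class p h x \<longleftrightarrow> (\<forall>i j. i mod p = j mod p \<and> i mod p \<noteq> h \<longrightarrow> x i = x j)"

text \<open>All blocks have length \<open>p\<close> and differ only at offset
  \<open>length A\<close>, so away from that offset the residue of the position determines the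
  letter. The letter \<open>c\<close> is a dummy that fills the hole.\<close>

lemma nth_concat_one_hole:
  assumes "i < length (concat (map (\<lambda>b. A @ b # B) v))"
    and "p = Suc (length A + length B)" and "i mod p \<noteq> length A"
  shows "concat (map (\<lambda>b. A @ b # B) v) ! i = (A @ c # B) ! (i mod p)"
  using assms
proof (induction v arbitrary: i)
  case (Cons b v)
  show ?case
  proof (cases "i < p")
    case True
    with Cons.prems show ?thesis
      by (auto simp: nth_append nth_Cons')
  next
    case False
    have "concat (map (\<lambda>b. A @ b # B) (b # v)) ! i = concat (map (\<lambda>b. A @ b # B) v) ! (i - p)"
      using False Cons.prems(2) nth_append_right[of "A @ b # B" i "concat (map (\<lambda>b. A @ b # B) v)"]
      by simp
    also have "\<dots> = (A @ c # B) ! ((i - p) mod p)"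
      using False Cons.prems by (intro Cons.IH) (auto simp: le_mod_geq)
    finally show ?thesis using False by (simp add: le_mod_geq)
  qed
qed simp

section \<open>Directive sequences whose morphisms have one free letter\<close>

context
  fixes \<sigma> :: "nat \<Rightarrow> 'a \<Rightarrow> 'a list" and u v :: "nat \<Rightarrow> 'a list"
  assumes one_hole: "\<And>n b. \<sigma> n b = u n @ b # v n"
    and nontrivial: "\<And>n. v n \<noteq> []"
begin

text \<open>Substituting a word with one hole into another one leaves one hole. At each level the
  nonempty \<open>v N\<close> adds at least one letter to the right of the hole, which makes the
  block lengths unbounded.\<close>

lemma morph_comp_one_hole: "\<exists>A B. N \<le> length B \<and> (\<forall>b. morph_comp \<sigma> N [b] = A @ b # B)"
proof (induction N)
  case 0
  show ?case by (intro exI[of _ "[]"]) simp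
next
  case (Suc N)
  then obtain A B where len: "N \<le> length B" and AB: "\<And>b. morph_comp \<sigma> N [b] = A @ b # B" by blast
  obtain c w where vN: "v N = c # w" using nontrivial[of N] by (cases "v N") auto
  have split: "morph_comp \<sigma> N (s # t) = morph_comp \<sigma> N [s] @ morph_comp \<sigma> N t" for s t
    using morph_comp_append[of \<sigma> N "[s]" t] by simp
  have "morph_comp \<sigma> (Suc N) [b] = (morph_comp \<sigma> N (u N) @ A) @ b # (B @ morph_comp \<sigma> N (v N))" for b
    by (simp add: morph_word_def one_hole morph_comp_append split[of b] AB)
  moreover have "Suc N \<le> length (B @ morph_comp \<sigma> N (v N))"
    using len by (simp add: vN split[of c] AB)
  ultimately show ?case by blast
qed

text \<open>Each letter occurs in its own image, so every word reappears one level higher. This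
  allows the level of a word that contains a given window to be raised until it splits into blocks
  of a prescribed level.\<close>

lemma sublist_morph_comp_mono:
  assumes "M \<le> N"
  shows "sublist (morph_comp \<sigma> M [b]) (morph_comp \<sigma> N [b])"
  using assms
proof (induction N rule: dec_induct)
  case (step N)
  have "morph_comp \<sigma> (Suc N) [b] = morph_comp \<sigma> N (u N) @ morph_comp \<sigma> N [b] @ morph_comp \<sigma> N (v N)"
    using morph_comp_append[of \<sigma> N "[b]" "v N"]
    by (simp add: morph_word_def one_hole morph_comp_append)
  then have "sublist (morph_comp \<sigma> N [b]) (morph_comp \<sigma> (Suc N) [b])"
    by (auto simp: sublist_def)
  with step.IH show ?case by (rule sublist_order.order.trans)
qed simp

text \<open>The period is the common length of the level-\<open>N\<close> blocks and serves all
  \<open>x\<close> at once; only \<open>h\<close> depends on \<open>x\<close>. Each finite window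
  lies in a concatenation of such blocks, which gives a class \<open>h\<close> valid on this window.
  Since there are only finitely many candidates, one of them is valid on all windows.\<close>

lemma directive_subshift_constant_off_class:
  "\<exists>p. p > int N \<and> (\<forall>x\<in>directive_subshift \<A> \<sigma>. \<exists>h. constant_off_class p h x)"
proof -
  obtain A B where len: "N \<le> length B" and AB: "\<And>b. morph_comp \<sigma> N [b] = A @ b # B"
    using morph_comp_one_hole by blast
  define p where "p = Suc (length A + length B)"
  have p: "p > N" using len by (simp add: p_def)
  have "\<exists>h. constant_off_class (int p) h x" if x: "x \<in> directive_subshift \<A> \<sigma>" for x
  proof -
    have win: "\<exists>h\<in>{0..<int p}. \<forall>i\<in>{-int L..int L}. \<forall>j\<in>{-int L..int L}.
        i mod int p = j mod int p \<and> i mod int p \<noteq> h \<longrightarrow> x i = x j" for L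
    proof -
      obtain M b where sub: "sublist (map x [-int L..int L]) (morph_comp \<sigma> M [b])"
        using x unfolding directive_subshift_def by blast
      define M' where "M' = max M N"
      obtain w where w: "morph_comp \<sigma> M' [b] = morph_comp \<sigma> N w"
        using morph_comp_factor[of N M'] by (auto simp: M'_def)
      have W: "morph_comp \<sigma> M' [b] = concat (map (\<lambda>b. A @ b # B) w)"
        unfolding w by (subst morph_comp_concat) (simp add: AB)
      have "sublist (map x [-int L..int L]) (morph_comp \<sigma> M' [b])"
        by (rule sublist_order.order.trans[OF sub sublist_morph_comp_mono]) (simp add: M'_def)
      then obtain ys zs where yz: "concat (map (\<lambda>b. A @ b # B) w) = ys @ map x [-int L..int L] @ zs"
        unfolding W sublist_def by blast
      have val: "x i = (A @ b # B) ! (nat (int (length ys) + i + int L) mod p)"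
        if i: "i \<in> {-int L..int L}" and ne: "nat (int (length ys) + i + int L) mod p \<noteq> length A" for i
      proof -
        define k where "k = nat (int (length ys) + i + int L)"
        have k: "k = length ys + nat (i + int L)" using i unfolding k_def atLeastAtMost_iff by linarith
        have "k < length (concat (map (\<lambda>b. A @ b # B) w))"
          unfolding yz using i by (simp add: k) linarith
        then have "concat (map (\<lambda>b. A @ b # B) w) ! k = (A @ b # B) ! (k mod p)"
          using ne by (intro nth_concat_one_hole) (auto simp: p_def k_def)
        moreover have "concat (map (\<lambda>b. A @ b # B) w) ! k = x i"
        proof -
          have "nat (i + int L) < length [-int L..int L]" using i by simp
          then show ?thesis unfolding yz k using i by (simp add: nth_append)
        qed
        ultimately show ?thesis by (simp add: k_def)
      qed
      \<comment> \<open>The letter \<open>x i\<close> sits at position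
        \<open>length ys + i + L\<close> of the concatenation, so \<open>h\<close> is the residue of
        those indices that land on the hole at offset \<open>length A\<close>.\<close>
      define h where "h = (int (length A) - int (length ys) - int L) mod int p"
      have idx: "int (nat (int (length ys) + i + int L) mod p) = (int (length ys) + i + int L) mod int p"
        if "i \<in> {-int L..int L}" for i
        using that by (simp add: zmod_int)
      have hole: "i mod int p = h" if i: "i \<in> {-int L..int L}"
        and eq: "nat (int (length ys) + i + int L) mod p = length A" for i
      proof -
        have "(int (length ys) + i + int L) mod int p = int (length A) mod int p"
          using idx[OF i] eq by (simp add: p_def)
        then have "(int (length ys) + i + int L - (int (length ys) + int L)) mod int p
            = (int (length A) - (int (length ys) + int L)) mod int p"
          by (rule mod_diff_cong) simp
        then show ?thesis by (simp add: h_def algebra_simps)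
      qed
      show ?thesis
      proof (intro bexI[of _ h] ballI impI)
        fix i j assume i: "i \<in> {-int L..int L}" and j: "j \<in> {-int L..int L}"
          and ij: "i mod int p = j mod int p \<and> i mod int p \<noteq> h"
        have "(i + (int (length ys) + int L)) mod int p = (j + (int (length ys) + int L)) mod int p"
          using ij by (intro mod_add_cong) auto
        then have "int (nat (int (length ys) + i + int L) mod p) = int (nat (int (length ys) + j + int L) mod p)"
          using idx[OF i] idx[OF j] by (simp add: algebra_simps)
        then have "nat (int (length ys) + i + int L) mod p = nat (int (length ys) + j + int L) mod p"
          by simp
        then show "x i = x j"
          using val[OF i] val[OF j] hole[OF i] hole[OF j] ij by metis
      qed (simp add: h_def p_def)
    qed
    show ?thesis
    proof (rule ccontr)
      assume "\<not> ?thesis"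
      then have "\<forall>h. \<exists>i j. i mod int p = j mod int p \<and> i mod int p \<noteq> h \<and> x i \<noteq> x j"
        unfolding constant_off_class_def by blast
      then obtain I J where IJ: "\<And>h. I h mod int p = J h mod int p \<and> I h mod int p \<noteq> h \<and> x (I h) \<noteq> x (J h)"
        by metis
      \<comment> \<open>If each \<open>h\<close> had a counterexample \<open>I h\<close>,
        \<open>J h\<close>, then a window containing the pairs for all \<open>p\<close> residues
        would refute every candidate at once. The sum is a crude bound for all these
        indices.\<close>
      define L where "L = (\<Sum>h\<in>{0..<int p}. nat \<bar>I h\<bar> + nat \<bar>J h\<bar>)"
      obtain h where h: "h \<in> {0..<int p}" and hL: "\<forall>i\<in>{-int L..int L}. \<forall>j\<in>{-int L..int L}.
        i mod int p = j mod int p \<and> i mod int p \<noteq> h \<longrightarrow> x i = x j"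
        using win[of L] by blast
      have "nat \<bar>I h\<bar> + nat \<bar>J h\<bar> \<le> L"
        unfolding L_def using h by (intro member_le_sum) auto
      then have "I h \<in> {-int L..int L}" "J h \<in> {-int L..int L}" by auto
      with hL IJ[of h] show False by blast
    qed
  qed
  with p show ?thesis by (intro exI[of _ "int p"]) auto
qed

end

text \<open>The free letter of \<open>tau q a (Suc n)\<close> stands between fixed words, and the
  last letter \<open>a n 0\<close> makes the right one nonempty.\<close>

lemma shifted_subshift_constant_off_class:
  "\<exists>p. p > int N \<and> (\<forall>x\<in>shifted_subshift q a. \<exists>h. constant_off_class p h x)"
  unfolding shifted_subshift_def
  by (rule directive_subshift_constant_off_class[where u = "\<lambda>n. map (a n) [1..<q n]" and v = "\<lambda>n. [a n 0]"])
    simp_all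

section \<open>Agreement of two sequences off a sparse set of indices\<close>

lemma constant_off_class_agree:
  assumes "constant_off_class p h x" "constant_off_class p h' y" "p > 0"
    and "\<And>i. 0 \<le> i \<Longrightarrow> i < p \<Longrightarrow> x i = y i"
    and "k mod p \<noteq> h" "k mod p \<noteq> h'"
  shows "x k = y k"
  \<comment> \<open>Both sequences take at \<open>k\<close> the value they have at
    \<open>k mod p\<close>, which lies in the window.\<close>
  using assms unfolding constant_off_class_def
  by (metis mod_mod_trivial pos_mod_bound pos_mod_sign)

text \<open>Two members of one residue class with the same quotient by \<open>p\<close> coincide,
  and there are at most \<open>n div p + 1\<close> quotients. The offset \<open>j\<close> stands for
  the coordinate observed after \<open>k\<close> shifts.\<close>

lemma card_residue_class_le:
  assumes "p > 0"
  shows "real (card {k\<in>{..<n}. (int k + j) mod p = h}) \<le> real n / real_of_int p + 1"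
proof -
  define S where "S = {k\<in>{..<n}. (int k + j) mod p = h}"
  have inj: "inj_on (\<lambda>k. k div nat p) S"
  proof (rule inj_onI)
    fix k l assume "k \<in> S" "l \<in> S" and div: "k div nat p = l div nat p"
    then have "(int k + j - j) mod p = (int l + j - j) mod p"
      by (intro mod_diff_cong) (auto simp: S_def)
    then have "int k mod int (nat p) = int l mod int (nat p)" using assms by simp
    then have "k mod nat p = l mod nat p" by (metis of_nat_eq_iff zmod_int)
    with div show "k = l" by (metis div_mult_mod_eq)
  qed
  have "(\<lambda>k. k div nat p) ` S \<subseteq> {..n div nat p}"
    by (auto simp: S_def intro!: div_le_mono)
  then have "card S \<le> n div nat p + 1"
    using card_inj_on_le[OF inj, of "{..n div nat p}"] by simp
  moreover have "real (n div nat p) \<le> real n / real_of_int p"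
    using of_nat_div_le_of_nat[of n "nat p", where ?'a = real] assms by simp
  ultimately show ?thesis unfolding S_def by linarith
qed

section \<open>The shift and the positions of blocks\<close>

lemma shift_funpow: "(shift ^^ n) x = (\<lambda>k. x (k + int n))"
  by (induction n) (auto simp: shift_def fun_eq_iff algebra_simps)

lemma morph_pos_0 [simp]: "morph_pos \<sigma> x 0 = 0"
  by (simp add: morph_pos_def)

lemma morph_pos_Suc: "morph_pos \<sigma> x (k + 1) = morph_pos \<sigma> x k + int (length (\<sigma> (x k)))"
proof (cases "k \<ge> 0")
  case True
  then have "{0..<k + 1} = insert k {0..<k}" by auto
  with True show ?thesis by (simp add: morph_pos_def)
next
  case False
  then have "{k..<0} = insert k {k + 1..<0}" by auto
  with False show ?thesis by (simp add: morph_pos_def)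
qed

text \<open>Positions for \<open>shift x\<close> are measured from the start of block
  \<open>1\<close> of \<open>x\<close>, because the normalisation puts block \<open>0\<close> of
  every sequence at coordinate \<open>0\<close>.\<close>

lemma morph_pos_shift: "morph_pos \<sigma> (shift x) k = morph_pos \<sigma> x (k + 1) - morph_pos \<sigma> x 1"
proof (induction k rule: int_induct[where k = 0])
  case (step1 k)
  have "shift x k = x (k + 1)" by (simp add: shift_def)
  then show ?case
    using step1.IH morph_pos_Suc[of \<sigma> "shift x" k] morph_pos_Suc[of \<sigma> x "k + 1"] by simp
next
  case (step2 k)
  have "shift x (k - 1) = x k" by (simp add: shift_def)
  with step2.IH show ?case
    using morph_pos_Suc[of \<sigma> "shift x" "k - 1"] morph_pos_Suc[of \<sigma> x k] by simp
qed simp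

lemma morph_pos_cong:
  assumes "\<And>i. \<bar>i\<bar> \<le> n \<Longrightarrow> x i = y i" and "\<bar>k\<bar> \<le> n"
  shows "morph_pos \<sigma> x k = morph_pos \<sigma> y k"
proof -
  have "(\<Sum>i\<in>{0..<k}. int (length (\<sigma> (x i)))) = (\<Sum>i\<in>{0..<k}. int (length (\<sigma> (y i))))"
    using assms by (intro sum.cong) auto
  moreover have "(\<Sum>i\<in>{k..<0}. int (length (\<sigma> (x i)))) = (\<Sum>i\<in>{k..<0}. int (length (\<sigma> (y i))))"
    using assms by (intro sum.cong) auto
  ultimately show ?thesis by (simp add: morph_pos_def)
qed

section \<open>Continuity in products of discrete spaces\<close>

lemma open_finite_dependence:
  fixes S :: "('i \<Rightarrow> 'a::discrete_topology) set"
  assumes "\<And>x. x \<in> S \<Longrightarrow> \<exists>J. finite J \<and> (\<forall>y. (\<forall>j\<in>J. x j = y j) \<longrightarrow> y \<in> S)"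
  shows "open S"
proof (subst open_subopen, intro ballI)
  fix x assume "x \<in> S"
  then obtain J where J: "finite J" "\<And>y. \<forall>j\<in>J. x j = y j \<Longrightarrow> y \<in> S" using assms by blast
  \<comment> \<open>The \<open>id\<close> is the index map that
    \<open>product_topology_basis'\<close> expects.\<close>
  have "open {y. \<forall>j\<in>J. y (id j) \<in> {x j}}"
    by (rule product_topology_basis') (use J in \<open>auto intro: open_discrete\<close>)
  with J(2) show "\<exists>T. open T \<and> x \<in> T \<and> T \<subseteq> S"
    by (intro exI[of _ "{y. \<forall>j\<in>J. y (id j) \<in> {x j}}"]) auto
qed

text \<open>Such an \<open>F\<close> is locally constant, so the preimage of every set is open,
  whatever the topology of the codomain.\<close>

lemma continuous_on_finite_dependence:
  fixes F :: "('i \<Rightarrow> 'a::discrete_topology) \<Rightarrow> 'b::topological_space"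
  assumes "\<And>x. \<exists>J. finite J \<and> (\<forall>y. (\<forall>j\<in>J. x j = y j) \<longrightarrow> F y = F x)"
  shows "continuous_on S F"
proof -
  have "open (F -` B)" for B
    by (rule open_finite_dependence) (metis assms vimage_eq)
  then have "continuous_on UNIV F" by (simp add: continuous_on_open_vimage)
  then show ?thesis by (rule continuous_on_subset) simp
qed

lemma continuous_on_shift: "continuous_on S (shift :: (int \<Rightarrow> 'a::topological_space) \<Rightarrow> _)"
proof -
  have "continuous_on UNIV (shift :: (int \<Rightarrow> 'a) \<Rightarrow> _)"
    unfolding shift_def
    by (intro continuous_on_coordinatewise_then_product continuous_on_product_coordinates)
  then show ?thesis by (rule continuous_on_subset) simp
qed

section \<open>Images of two-sided sequences under a nonerasing morphism\<close>

context
  fixes \<sigma> :: "'a \<Rightarrow> 'b list"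
  assumes nonerasing: "\<And>b. \<sigma> b \<noteq> []"
begin

lemma morph_pos_less_Suc: "morph_pos \<sigma> x k < morph_pos \<sigma> x (k + 1)"
  using nonerasing by (simp add: morph_pos_Suc)

lemma morph_pos_strict_mono: "k < l \<Longrightarrow> morph_pos \<sigma> x k < morph_pos \<sigma> x l"
proof (induction l rule: int_gr_induct[where k = k])
  case base
  show ?case by (rule morph_pos_less_Suc)
next
  case (step l)
  then show ?case using morph_pos_less_Suc[of x l] by simp
qed

lemma morph_pos_less_iff: "morph_pos \<sigma> x k < morph_pos \<sigma> x l \<longleftrightarrow> k < l"
  using morph_pos_strict_mono[of k l x] morph_pos_strict_mono[of l k x]
  by (cases k l rule: linorder_cases) auto

lemma morph_pos_le_iff: "morph_pos \<sigma> x k \<le> morph_pos \<sigma> x l \<longleftrightarrow> k \<le> l"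
  using morph_pos_less_iff[of x l k] by linarith

text \<open>Every block has length at least one. This bounds the index of the block that covers a
  given coordinate.\<close>

lemma morph_pos_expanding: "k \<ge> 0 \<Longrightarrow> k \<le> morph_pos \<sigma> x k" "k \<le> 0 \<Longrightarrow> morph_pos \<sigma> x k \<le> k"
proof -
  show "k \<le> morph_pos \<sigma> x k" if "k \<ge> 0" using that
  proof (induction k rule: int_ge_induct)
    case (step k)
    then show ?case using morph_pos_less_Suc[of x k] by simp
  qed simp
  show "morph_pos \<sigma> x k \<le> k" if "k \<le> 0" using that
  proof (induction k rule: int_le_induct)
    case (step k)
    then show ?case using morph_pos_less_Suc[of x "k - 1"] by simp
  qed simp
qed

lemma morph_block_exists: "\<exists>k. morph_pos \<sigma> x k \<le> m \<and> m < morph_pos \<sigma> x (k + 1)"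
proof (induction m rule: int_induct[where k = 0])
  case base
  show ?case using morph_pos_less_Suc[of x 0] by (intro exI[of _ 0]) simp
next
  case (step1 m)
  then obtain k where k: "morph_pos \<sigma> x k \<le> m" "m < morph_pos \<sigma> x (k + 1)" by blast
  show ?case
  proof (cases "m + 1 < morph_pos \<sigma> x (k + 1)")
    case True
    with k show ?thesis by (intro exI[of _ k]) simp
  next
    case False
    with k morph_pos_less_Suc[of x "k + 1"] show ?thesis by (intro exI[of _ "k + 1"] conjI) linarith+
  qed
next
  case (step2 m)
  then obtain k where k: "morph_pos \<sigma> x k \<le> m" "m < morph_pos \<sigma> x (k + 1)" by blast
  show ?case
  proof (cases "morph_pos \<sigma> x k \<le> m - 1")
    case True
    with k show ?thesis by (intro exI[of _ k]) simp
  next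
    case False
    with k morph_pos_less_Suc[of x "k - 1"] show ?thesis by (intro exI[of _ "k - 1"]) simp
  qed
qed

text \<open>Positions increase strictly, so the covering block is unique and the definite
  description in \<open>morph_seq\<close> evaluates to \<open>k\<close>.\<close>

lemma morph_seq_eq:
  assumes "morph_pos \<sigma> x k \<le> m" "m < morph_pos \<sigma> x (k + 1)"
  shows "morph_seq \<sigma> x m = \<sigma> (x k) ! nat (m - morph_pos \<sigma> x k)"
proof -
  have "l = k" if "morph_pos \<sigma> x l \<le> m" "m < morph_pos \<sigma> x (l + 1)" for l
    using that assms morph_pos_less_iff[of x l "k + 1"] morph_pos_less_iff[of x k "l + 1"] by linarith
  with assms have "(THE k. morph_pos \<sigma> x k \<le> m \<and> m < morph_pos \<sigma> x (k + 1)) = k"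
    by (intro the_equality conjI) blast+
  then show ?thesis by (simp add: morph_seq_def)
qed

text \<open>Block \<open>k\<close> of \<open>shift x\<close> is block \<open>k + 1\<close> of
  \<open>x\<close>, and the origin moves past the block of \<open>x 0\<close>.\<close>

lemma morph_seq_shift: "morph_seq \<sigma> (shift x) = (shift ^^ length (\<sigma> (x 0))) (morph_seq \<sigma> x)"
proof
  fix m
  let ?c = "morph_pos \<sigma> x 1"
  have c: "?c = int (length (\<sigma> (x 0)))"
    using morph_pos_Suc[of \<sigma> x 0] by simp
  obtain k where k: "morph_pos \<sigma> (shift x) k \<le> m" "m < morph_pos \<sigma> (shift x) (k + 1)"
    using morph_block_exists by blast
  have "morph_seq \<sigma> (shift x) m = \<sigma> (shift x k) ! nat (m - morph_pos \<sigma> (shift x) k)"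
    using k by (rule morph_seq_eq)
  also have "\<dots> = \<sigma> (x (k + 1)) ! nat (m + ?c - morph_pos \<sigma> x (k + 1))"
    unfolding morph_pos_shift by (simp add: shift_def diff_diff_eq2)
  also have "\<dots> = morph_seq \<sigma> x (m + ?c)"
  proof (rule morph_seq_eq[symmetric])
    show "morph_pos \<sigma> x (k + 1) \<le> m + ?c" using k(1) unfolding morph_pos_shift by linarith
    show "m + ?c < morph_pos \<sigma> x (k + 1 + 1)" using k(2) unfolding morph_pos_shift by linarith
  qed
  finally show "morph_seq \<sigma> (shift x) m = (shift ^^ length (\<sigma> (x 0))) (morph_seq \<sigma> x) m"
    by (simp only: shift_funpow c)
qed

text \<open>The block \<open>k\<close> covering \<open>m\<close> satisfies
  \<open>\<bar>k\<bar> \<le> \<bar>m\<bar>\<close>: for \<open>k \<ge> 0\<close> its start is at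
  least \<open>k\<close>, and for \<open>k < 0\<close> its end is at most \<open>k + 1\<close>. The
  extra \<open>1\<close> in the window accommodates the position of block
  \<open>k + 1\<close>.\<close>

lemma morph_seq_cong:
  assumes "\<And>i. \<bar>i\<bar> \<le> \<bar>m\<bar> + 1 \<Longrightarrow> x i = y i"
  shows "morph_seq \<sigma> x m = morph_seq \<sigma> y m"
proof -
  obtain k where k: "morph_pos \<sigma> x k \<le> m" "m < morph_pos \<sigma> x (k + 1)"
    using morph_block_exists by blast
  have "\<bar>k\<bar> \<le> \<bar>m\<bar>"
    using k morph_pos_expanding(1)[of k x] morph_pos_expanding(2)[of "k + 1" x]
    by (cases "k \<ge> 0") auto
  then have pos: "morph_pos \<sigma> x k = morph_pos \<sigma> y k" "morph_pos \<sigma> x (k + 1) = morph_pos \<sigma> y (k + 1)"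
    and xy: "x k = y k"
    using assms by (auto intro!: morph_pos_cong[where n = "\<bar>m\<bar> + 1"])
  have "morph_seq \<sigma> y m = \<sigma> (y k) ! nat (m - morph_pos \<sigma> y k)"
    using k pos by (intro morph_seq_eq) auto
  with pos xy morph_seq_eq[OF k] show ?thesis by simp
qed

end

lemma continuous_on_morph_seq:
  fixes \<sigma> :: "'a::discrete_topology \<Rightarrow> 'b::topological_space list"
  assumes "\<And>b. \<sigma> b \<noteq> []"
  shows "continuous_on S (morph_seq \<sigma>)"
proof (rule continuous_on_coordinatewise_then_product, rule continuous_on_finite_dependence)
  fix m and x :: "int \<Rightarrow> 'a"
  show "\<exists>J. finite J \<and> (\<forall>y. (\<forall>j\<in>J. x j = y j) \<longrightarrow> morph_seq \<sigma> y m = morph_seq \<sigma> x m)"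
  proof (intro exI[of _ "{-(\<bar>m\<bar> + 1)..\<bar>m\<bar> + 1}"] conjI allI impI)
    fix y assume "\<forall>j\<in>{-(\<bar>m\<bar> + 1)..\<bar>m\<bar> + 1}. x j = y j"
    then show "morph_seq \<sigma> y m = morph_seq \<sigma> x m"
      by (intro morph_seq_cong[OF assms]) (simp add: abs_le_iff)
  qed simp
qed

section \<open>The morphism \<open>tau q a 0\<close> and the induced map\<close>

lemma tau_0_nonerasing: "tau q a 0 b \<noteq> []"
  by simp

lemma morph_pos_tau_0_Suc:
  "morph_pos (tau q a 0) x (k + 1) = morph_pos (tau q a 0) x k + 1 + int (x k)"
  using morph_pos_Suc[of "tau q a 0" x k] by simp

text \<open>Each block consists of a single \<open>0\<close> followed by ones, so the zeros of the
  image mark exactly the block starts.\<close>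

lemma morph_seq_tau_0_eq_0_iff:
  "morph_seq (tau q a 0) x m = 0 \<longleftrightarrow> m \<in> range (morph_pos (tau q a 0) x)"
proof -
  obtain k where k: "morph_pos (tau q a 0) x k \<le> m" "m < morph_pos (tau q a 0) x (k + 1)"
    using morph_block_exists[of "tau q a 0", OF tau_0_nonerasing] by blast
  have "morph_seq (tau q a 0) x m = tau q a 0 (x k) ! nat (m - morph_pos (tau q a 0) x k)"
    using k by (rule morph_seq_eq[of "tau q a 0", OF tau_0_nonerasing])
  also have "\<dots> = 0 \<longleftrightarrow> m = morph_pos (tau q a 0) x k"
    using k morph_pos_tau_0_Suc[of q a x k] by (auto simp: nth_Cons')
  also have "\<dots> \<longleftrightarrow> m \<in> range (morph_pos (tau q a 0) x)"
  proof
    assume "m \<in> range (morph_pos (tau q a 0) x)"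
    then obtain l where l: "m = morph_pos (tau q a 0) x l" by blast
    with k have "k \<le> l" "l < k + 1"
      by (simp_all only: morph_pos_le_iff[of "tau q a 0", OF tau_0_nonerasing] morph_pos_less_iff[of "tau q a 0", OF tau_0_nonerasing])
    then show "m = morph_pos (tau q a 0) x k" using l by simp
  qed blast
  finally show ?thesis .
qed

text \<open>The zeros of the image determine the set of block starts. Two increasing enumerations of
  this set that agree at \<open>0\<close> agree everywhere, and each letter is the gap between
  consecutive starts minus one.\<close>

lemma inj_morph_seq_tau_0: "inj (morph_seq (tau q a 0))"
proof (rule injI)
  fix x y assume eq: "morph_seq (tau q a 0) x = morph_seq (tau q a 0) y"
  let ?P = "morph_pos (tau q a 0)"
  note less_iff = morph_pos_less_iff[of "tau q a 0", OF tau_0_nonerasing]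
  have range_eq: "range (?P x) = range (?P y)"
    by (rule set_eqI) (simp only: eq flip: morph_seq_tau_0_eq_0_iff)
  have not_between: "\<not> (?P z k < s \<and> s < ?P z (k + 1))" if "s \<in> range (?P z)" for z k s
    using that less_iff[of z k] less_iff[of z _ "k + 1"] by force
  have step: "?P x (k + 1) = ?P y (k + 1)" if "?P x k = ?P y k" for k
  proof (rule linorder_cases)
    assume "?P x (k + 1) < ?P y (k + 1)"
    then show ?thesis
      using that less_iff[of x k "k + 1"] not_between[of "?P x (k + 1)" y k] range_eq by auto
  next
    assume "?P y (k + 1) < ?P x (k + 1)"
    then show ?thesis
      using that less_iff[of y k "k + 1"] not_between[of "?P y (k + 1)" x k] range_eq by auto
  qed
  have step': "?P x (k - 1) = ?P y (k - 1)" if "?P x k = ?P y k" for k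
  proof (rule linorder_cases)
    assume "?P x (k - 1) < ?P y (k - 1)"
    then show ?thesis
      using that less_iff[of y "k - 1" k] not_between[of "?P y (k - 1)" x "k - 1"] range_eq by auto
  next
    assume "?P y (k - 1) < ?P x (k - 1)"
    then show ?thesis
      using that less_iff[of x "k - 1" k] not_between[of "?P x (k - 1)" y "k - 1"] range_eq by auto
  qed
  have pos: "?P x k = ?P y k" for k
    by (induction k rule: int_induct[where k = 0]) (simp only: morph_pos_0, erule step, erule step')
  show "x = y"
  proof
    fix k
    show "x k = y k"
      using pos[of k] pos[of "k + 1"] morph_pos_tau_0_Suc[of q a x k] morph_pos_tau_0_Suc[of q a y k]
      by linarith
  qed
qed

text \<open>Every point of the image set has a \<open>0\<close> at the origin, so a return can
  happen only at a block start, and the first positive one is \<open>Suc (x 0)\<close>. There the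
  orbit does return, at the image of \<open>shift x\<close>.\<close>

lemma induced_map_morph_seq_tau_0:
  assumes "x \<in> X" and "shift x \<in> X"
  shows "induced_map shift (morph_seq (tau q a 0) ` X) (morph_seq (tau q a 0) x)
    = morph_seq (tau q a 0) (shift x)"
proof -
  let ?f = "morph_seq (tau q a 0)" and ?P = "morph_pos (tau q a 0)"
  have shift: "?f (shift x) = (shift ^^ Suc (x 0)) (?f x)"
    using morph_seq_shift[of "tau q a 0", OF tau_0_nonerasing, of x] by simp
  have "Inf {n. n > 0 \<and> (shift ^^ n) (?f x) \<in> ?f ` X} = Suc (x 0)"
  proof (rule cInf_eq_minimum)
    show "Suc (x 0) \<in> {n. n > 0 \<and> (shift ^^ n) (?f x) \<in> ?f ` X}"
      using assms(2) shift by (metis (mono_tags) imageI mem_Collect_eq zero_less_Suc)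
  next
    fix n assume "n \<in> {n. n > 0 \<and> (shift ^^ n) (?f x) \<in> ?f ` X}"
    then obtain z where n: "n > 0" and z: "(shift ^^ n) (?f x) = ?f z" by auto
    have "?f z 0 = 0"
      by (metis morph_seq_tau_0_eq_0_iff morph_pos_0 rangeI)
    then have "?f x (int n) = 0" using z by (metis shift_funpow add_0)
    then obtain k where k: "int n = ?P x k" by (auto simp: morph_seq_tau_0_eq_0_iff)
    with n have "?P x 0 < ?P x k" by simp
    then have "0 + 1 \<le> k" by (simp only: morph_pos_less_iff[of "tau q a 0", OF tau_0_nonerasing])
    then have "?P x (0 + 1) \<le> ?P x k" by (simp only: morph_pos_le_iff[of "tau q a 0", OF tau_0_nonerasing])
    with k show "Suc (x 0) \<le> n" by (simp only: morph_pos_tau_0_Suc) simp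
  qed
  then show ?thesis by (simp only: induced_map_def return_time_def shift)
qed

section \<open>Shift invariance and compactness of directive subshifts\<close>

lemma shift_directive_subshift: "shift ` directive_subshift A \<sigma> = directive_subshift A \<sigma>"
proof -
  \<comment> \<open>Membership constrains all windows alike, so it survives translation;
    \<open>c = 1\<close> and \<open>c = -1\<close> give the two inclusions.\<close>
  have translate: "(\<lambda>k. x (k + c)) \<in> directive_subshift A \<sigma>" if x: "x \<in> directive_subshift A \<sigma>" for x c
  proof -
    have "map (\<lambda>k. x (k + c)) [i..j] = map x [i + c..j + c]" for i j
      by (rule nth_equalityI) (simp_all add: algebra_simps)
    then show ?thesis using x unfolding directive_subshift_def by auto
  qed
  show ?thesis
  proof
    show "shift ` directive_subshift A \<sigma> \<subseteq> directive_subshift A \<sigma>"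
      using translate[of _ 1] by (auto simp: shift_def)
    show "directive_subshift A \<sigma> \<subseteq> shift ` directive_subshift A \<sigma>"
    proof
      fix x assume x: "x \<in> directive_subshift A \<sigma>"
      have "x = shift (\<lambda>k. x (k + (- 1)))" by (simp add: shift_def)
      with translate[OF x, of "-1"] show "x \<in> shift ` directive_subshift A \<sigma>" by blast
    qed
  qed
qed

text \<open>A failure of membership shows on finitely many coordinates, so the set is closed in a
  product of finite sets, which is compact.\<close>

lemma compact_directive_subshift:
  fixes A :: "nat \<Rightarrow> 'a::discrete_topology set"
  assumes "finite (A 0)"
  shows "compact (directive_subshift A \<sigma>)"
proof -
  have "compactin (product_topology (\<lambda>_::int. euclidean) UNIV) (PiE UNIV (\<lambda>_. A 0))"
    using assms by (simp add: compactin_PiE finite_imp_compact)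
  then have "compact (PiE (UNIV::int set) (\<lambda>_. A 0))"
    by (simp add: euclidean_product_topology)
  moreover have "closed (directive_subshift A \<sigma>)"
    unfolding closed_def
  proof (rule open_finite_dependence)
    fix x assume x: "x \<in> - directive_subshift A \<sigma>"
    show "\<exists>J. finite J \<and> (\<forall>y. (\<forall>j\<in>J. x j = y j) \<longrightarrow> y \<in> - directive_subshift A \<sigma>)"
    proof (cases "range x \<subseteq> A 0")
      case False
      then obtain k where "x k \<notin> A 0" by blast
      then have "y \<in> - directive_subshift A \<sigma>" if "x k = y k" for y
        using that \<open>x k \<notin> A 0\<close> unfolding directive_subshift_def by (auto simp only: image_subset_iff)
      then show ?thesis by (intro exI[of _ "{k}"]) simp
    next
      case True
      with x obtain i j where ij: "\<not> (\<exists>N>0. \<exists>b\<in>A N. sublist (map x [i..j]) (morph_comp \<sigma> N [b]))"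
        unfolding directive_subshift_def by auto
      have "y \<in> - directive_subshift A \<sigma>" if "\<forall>k\<in>{i..j}. x k = y k" for y
      proof -
        have "map y [i..j] = map x [i..j]" using that by (intro map_cong) auto
        moreover have "\<exists>N>0. \<exists>b\<in>A N. sublist (map y [i..j]) (morph_comp \<sigma> N [b])"
          if "y \<in> directive_subshift A \<sigma>"
          using that unfolding directive_subshift_def by blast
        ultimately show ?thesis using ij by (metis ComplI)
      qed
      then show ?thesis by (intro exI[of _ "{i..j}"]) simp
    qed
  qed
  moreover have "directive_subshift A \<sigma> \<subseteq> PiE UNIV (\<lambda>_. A 0)"
    by (auto simp: directive_subshift_def)
  ultimately show ?thesis by (metis compact_Int_closed inf.absorb2)
qed

text \<open>This is how bounded spacers yield compactness of the shifted subshift.\<close>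

lemma finite_alphabet:
  assumes "bounded_spacers q a"
  shows "finite (alphabet q a (Suc n))"
proof -
  obtain B where "\<forall>n. \<forall>i<q n. a n i \<le> B" using assms by (auto simp: bounded_spacers_def)
  then have "alphabet q a (Suc n) \<subseteq> {..B}" by auto
  then show ?thesis by (rule finite_subset) simp
qed

section \<open>Uniformity on compact sets\<close>

lemma open_contains_cylinder:
  fixes S :: "('i \<Rightarrow> 'a::topological_space) set"
  assumes "open S" "x \<in> S"
  obtains J where "finite J" "\<And>y. \<forall>j\<in>J. x j = y j \<Longrightarrow> y \<in> S"
proof -
  obtain W where W: "x \<in> PiE UNIV W" "finite {i. W i \<noteq> UNIV}" "PiE UNIV W \<subseteq> S"
    using product_topology_open_contains_basis[of "\<lambda>_. euclidean" UNIV S x] assms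
    by (auto simp: open_fun_def)
  have "y \<in> S" if "\<forall>j\<in>{i. W i \<noteq> UNIV}. x j = y j" for y
  proof -
    have "y j \<in> W j" for j
    proof (cases "W j = UNIV")
      case False
      with that have "y j = x j" by simp
      with W(1) show ?thesis by auto
    qed simp
    with W(3) show ?thesis by auto
  qed
  with W(2) show thesis by (rule that)
qed

text \<open>This is uniform continuity with agreement on finitely many coordinates in place of
  closeness in a metric on the domain. Finitely many cylinders cover \<open>X\<close>, and
  \<open>J\<close> collects their coordinates; two points that agree on \<open>J\<close> lie in a
  common cylinder and are compared through its centre, hence the halves of
  \<open>\<epsilon>\<close>.\<close>

lemma uniformly_continuous_finite_dependence:
  fixes f :: "('i \<Rightarrow> 'a::discrete_topology) \<Rightarrow> 'b"
  assumes "Metric_space M d" and "compact X"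
    and cont: "continuous_map (top_of_set X) (Metric_space.mtopology M d) f" and "\<epsilon> > 0"
  obtains J where "finite J" "\<And>x y. x \<in> X \<Longrightarrow> y \<in> X \<Longrightarrow> \<forall>j\<in>J. x j = y j \<Longrightarrow> d (f x) (f y) < \<epsilon>"
proof -
  interpret Metric_space M d by fact
  have f_M: "f x \<in> M" if "x \<in> X" for x
    using continuous_map_funspace[OF cont] that by auto
  have "\<exists>J. finite J \<and> (\<forall>y\<in>X. (\<forall>j\<in>J. x j = y j) \<longrightarrow> d (f x) (f y) < \<epsilon> / 2)" if x: "x \<in> X" for x
  proof -
    have "openin (top_of_set X) {y \<in> topspace (top_of_set X). f y \<in> mball (f x) (\<epsilon> / 2)}"
      using cont by (rule openin_continuous_map_preimage) simp
    then obtain W where "open W" and W: "{y \<in> X. f y \<in> mball (f x) (\<epsilon> / 2)} = X \<inter> W"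
      by (auto simp: openin_open)
    have "x \<in> {y \<in> X. f y \<in> mball (f x) (\<epsilon> / 2)}" using x f_M[OF x] \<open>\<epsilon> > 0\<close> by simp
    then have "x \<in> W" unfolding W by simp
    with \<open>open W\<close> obtain J where "finite J" and J: "\<And>y. \<forall>j\<in>J. x j = y j \<Longrightarrow> y \<in> W"
      using open_contains_cylinder by blast
    have "d (f x) (f y) < \<epsilon> / 2" if "y \<in> X" "\<forall>j\<in>J. x j = y j" for y
    proof -
      have "y \<in> X \<inter> W" using J[OF that(2)] that(1) by simp
      then have "f y \<in> mball (f x) (\<epsilon> / 2)" unfolding W[symmetric] by simp
      then show ?thesis by simp
    qed
    with \<open>finite J\<close> show ?thesis by blast
  qed
  then obtain J where fin: "\<And>x. x \<in> X \<Longrightarrow> finite (J x)"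
    and J: "\<And>x y. x \<in> X \<Longrightarrow> y \<in> X \<Longrightarrow> \<forall>j\<in>J x. x j = y j \<Longrightarrow> d (f x) (f y) < \<epsilon> / 2"
    by metis
  have "open {y. \<forall>j\<in>J x. x j = y j}" if "x \<in> X" for x
    using fin[OF that] by (intro open_finite_dependence) auto
  then obtain F where F: "F \<subseteq> X" "finite F" "X \<subseteq> (\<Union>x\<in>F. {y. \<forall>j\<in>J x. x j = y j})"
    using compactE_image[OF \<open>compact X\<close>, of X "\<lambda>x. {y. \<forall>j\<in>J x. x j = y j}"] by blast
  show thesis
  proof
    show "finite (\<Union>x\<in>F. J x)" using F fin by auto
    fix x y assume x: "x \<in> X" and y: "y \<in> X" and eq: "\<forall>j\<in>\<Union>x\<in>F. J x. x j = y j"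
    obtain z where z: "z \<in> F" "\<forall>j\<in>J z. z j = x j" using F(3) x by blast
    with eq have "\<forall>j\<in>J z. z j = y j" by auto
    with z F(1) x y have "d (f z) (f x) < \<epsilon> / 2" "d (f z) (f y) < \<epsilon> / 2" using J by auto
    moreover have "d (f x) (f y) \<le> d (f z) (f x) + d (f z) (f y)"
      using triangle[of "f x" "f z" "f y"] commute[of "f x" "f z"] f_M x y z(1) F(1) by auto
    ultimately show "d (f x) (f y) < \<epsilon>" by linarith
  qed
qed

text \<open>By compactness \<open>real \<circ> g\<close> is uniformly continuous, and natural
  numbers at distance below \<open>1\<close> are equal.\<close>

lemma uniformly_locally_constant:
  fixes g :: "'a \<Rightarrow> nat"
  assumes "Metric_space M d" and "compact_space (Metric_space.mtopology M d)"
    and "continuous_map (Metric_space.mtopology M d) euclidean g"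
  obtains \<delta> where "\<delta> > 0" "\<And>x y. x \<in> M \<Longrightarrow> y \<in> M \<Longrightarrow> d x y < \<delta> \<Longrightarrow> g x = g y"
proof -
  interpret Metric_space M d by fact
  have "continuous_map euclidean euclidean real" by simp
  then have "continuous_map mtopology euclidean (real \<circ> g)"
    using assms(3) continuous_map_compose by blast
  then have "uniformly_continuous_map (metric (M, d)) euclidean_metric (real \<circ> g)"
    using assms(2)
    by (subst continuous_eq_uniformly_continuous_map[symmetric])
       (simp_all add: mtopology_of_def)
  then obtain \<delta> where "\<delta> > 0"
    and \<delta>: "\<And>x y. x \<in> M \<Longrightarrow> y \<in> M \<Longrightarrow> d y x < \<delta> \<Longrightarrow> dist (real (g y)) (real (g x)) < 1"
    unfolding uniformly_continuous_map_def by (force dest: spec[of _ "1::real"])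
  have "g x = g y" if "x \<in> M" "y \<in> M" "d x y < \<delta>" for x y
    using \<delta>[OF that(2,1,3)] by (simp add: dist_real_def)
  with \<open>\<delta> > 0\<close> show thesis by (rule that)
qed

section \<open>Averages with a sparse set of bad times\<close>

lemma average_le_bad_set:
  fixes D :: "nat \<Rightarrow> real"
  assumes le_C: "\<And>k. D k \<le> C" and "C \<ge> 0" "\<epsilon> \<ge> 0"
    and good: "\<And>k. k \<notin> B \<Longrightarrow> D k \<le> \<epsilon>"
  shows "(1 / real n) * (\<Sum>k<n. D k) \<le> \<epsilon> + C * (real (card ({..<n} \<inter> B)) / real n)"
\<comment> \<open>For \<open>n = 0\<close> both quotients are \<open>0\<close> by convention and the
  claim reduces to \<open>0 \<le> \<epsilon>\<close>.\<close>
proof (cases "n = 0")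
  case False
  have "(\<Sum>k<n. D k) \<le> (\<Sum>k<n. \<epsilon> + (if k \<in> B then C else 0))"
    using assms by (intro sum_mono) (auto intro: add_increasing)
  also have "\<dots> = real n * \<epsilon> + C * real (card ({..<n} \<inter> B))"
    by (simp add: sum.distrib flip: sum.inter_restrict)
  finally show ?thesis using False by (simp add: field_simps)
qed (use assms in simp)

text \<open>A union bound: each observed coordinate \<open>j\<close> contributes two residue
  classes, one for each of the two sequences.\<close>

lemma card_residue_classes_le:
  assumes "finite J" "p > 0"
  shows "real (card ({..<n} \<inter> {k. \<exists>j\<in>J. (int k + j) mod p = h \<or> (int k + j) mod p = h'}))
    \<le> real (card J) * (2 * (real n / real_of_int p + 1))"
proof -
  define S where "S j r = {k\<in>{..<n}. (int k + j) mod p = r}" for j r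
  have "card ({..<n} \<inter> {k. \<exists>j\<in>J. (int k + j) mod p = h \<or> (int k + j) mod p = h'})
      = card (\<Union>j\<in>J. S j h \<union> S j h')"
    by (rule arg_cong[where f = card]) (auto simp: S_def)
  also have "\<dots> \<le> (\<Sum>j\<in>J. card (S j h \<union> S j h'))"
    using \<open>finite J\<close> by (rule card_UN_le)
  also have "\<dots> \<le> (\<Sum>j\<in>J. card (S j h) + card (S j h'))"
    by (intro sum_mono card_Un_le)
  finally have "real (card ({..<n} \<inter> {k. \<exists>j\<in>J. (int k + j) mod p = h \<or> (int k + j) mod p = h'}))
      \<le> real (\<Sum>j\<in>J. card (S j h) + card (S j h'))"
    by (simp only: of_nat_le_iff)
  also have "\<dots> = (\<Sum>j\<in>J. real (card (S j h)) + real (card (S j h')))"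
    by simp
  also have "\<dots> \<le> real (card J) * (2 * (real n / real_of_int p + 1))"
  proof (rule sum_bounded_above)
    fix j
    show "real (card (S j h)) + real (card (S j h')) \<le> 2 * (real n / real_of_int p + 1)"
      unfolding S_def mult_2 by (intro add_mono card_residue_class_le[OF \<open>p > 0\<close>])
  qed
  finally show ?thesis .
qed

section \<open>Conjugacy of the induced map with the shift, and the mean estimate\<close>

theorem proposition4p5:
  fixes q :: "nat \<Rightarrow> nat" and a :: "nat \<Rightarrow> nat \<Rightarrow> nat"
    and d :: "(int \<Rightarrow> nat) \<Rightarrow> (int \<Rightarrow> nat) \<Rightarrow> real"
  assumes "standard q"
    and "bounded_spacers q a"
    and "aperiodic (ferenczi_subshift q a)"
    and "compatible_metric (ferenczi_base q a) d"
  shows "mean_equicontinuous (ferenczi_base q a) d (induced_map shift (ferenczi_base q a))"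
proof -
  define X where "X = shifted_subshift q a"
  define U where "U = ferenczi_base q a"
  define f where "f = morph_seq (tau q a 0)"
  define T where "T = induced_map shift U"
  have U_eq: "U = f ` X" by (simp add: U_def X_def f_def ferenczi_base_def)
  have shift_X: "shift ` X = X"
    unfolding X_def shifted_subshift_def by (rule shift_directive_subshift)
  have shift_in: "shift x \<in> X" if "x \<in> X" for x
    using imageI[OF that, of shift] by (simp only: shift_X)
  have inj: "inj_on f X" unfolding f_def using inj_morph_seq_tau_0 by (rule inj_on_subset) simp
  have compact_X: "compact X"
    unfolding X_def shifted_subshift_def
    by (rule compact_directive_subshift) (use finite_alphabet[OF assms(2), of 0] in simp)
  have cont_f: "continuous_on X f"
    unfolding f_def by (rule continuous_on_morph_seq) (rule tau_0_nonerasing)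
  have compact_U: "compact U" unfolding U_eq using cont_f compact_X by (rule compact_continuous_image)
  interpret Metric_space U d
    using assms(4) by (simp add: compatible_metric_def U_def)
  have mtop: "mtopology = top_of_set U"
    using assms(4) by (simp add: compatible_metric_def U_def)
  \<comment> \<open>A continuous injection of a compact space into a Hausdorff space is a
    homeomorphism onto its image; its inverse \<open>g\<close> decodes points of
    \<open>U\<close>.\<close>
  have "homeomorphic_map (top_of_set X) (top_of_set U) f"
  proof (rule continuous_imp_homeomorphic_map)
    show "Hausdorff_space (top_of_set U)" using Hausdorff_space_mtopology by (simp add: mtop)
  qed (use compact_X cont_f inj in \<open>simp_all add: U_eq compact_space_subtopology\<close>)
  then obtain g where g: "homeomorphic_maps (top_of_set X) (top_of_set U) f g"
    using homeomorphic_map_maps by blast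
  have cont_g: "continuous_on U g"
    and g_U: "\<And>u. u \<in> U \<Longrightarrow> g u \<in> X" "\<And>u. u \<in> U \<Longrightarrow> f (g u) = u"
    using g by (auto simp: homeomorphic_maps_def)
  have T_f: "T (f x) = f (shift x)" if "x \<in> X" for x
    unfolding T_def U_eq f_def using that shift_in by (intro induced_map_morph_seq_tau_0)
  have T_eq: "T u = f (shift (g u))" if "u \<in> U" for u
    using T_f[of "g u"] g_U[OF that] by simp
  have tds: "top_dyn_system U d T"
  proof -
    have "homeomorphic_map (top_of_set U) (top_of_set U) T"
    \<comment> \<open>The same principle gives continuity of the inverse of \<open>T\<close>, once
      \<open>T\<close> is shown to be a continuous bijection of \<open>U\<close>.\<close>
    proof (rule continuous_imp_homeomorphic_map)
      have "continuous_on U (shift \<circ> g)"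
        using cont_g continuous_on_shift by (rule continuous_on_compose)
      moreover have "continuous_on ((shift \<circ> g) ` U) f"
        using cont_f by (rule continuous_on_subset) (auto intro: g_U(1) shift_in)
      ultimately have "continuous_on U (f \<circ> (shift \<circ> g))"
        by (rule continuous_on_compose)
      then have "continuous_on U (\<lambda>u. f (shift (g u)))" by (simp only: comp_def)
      then have "continuous_on U T" by (rule continuous_on_eq) (simp only: T_eq)
      moreover have image: "T ` U = U"
      proof -
        have "T ` U = (\<lambda>x. f (shift x)) ` X"
          unfolding U_eq image_image by (rule image_cong[OF refl T_f])
        also have "\<dots> = f ` shift ` X" by (simp add: image_image)
        finally show ?thesis by (simp only: shift_X U_eq)
      qed
      ultimately show "continuous_map (top_of_set U) (top_of_set U) T" by auto
      show "T ` topspace (top_of_set U) = topspace (top_of_set U)" using image by simp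
      have "inj_on (\<lambda>u. f (shift (g u))) U"
      proof (rule inj_onI)
        fix u v assume u: "u \<in> U" and v: "v \<in> U" and "f (shift (g u)) = f (shift (g v))"
        then have eq: "shift (g u) = shift (g v)" using u v g_U(1) shift_in by (blast intro: inj_onD[OF inj])
        have "g u k = g v k" for k
        proof -
          have "g u k = shift (g u) (k - 1)" by (simp add: shift_def)
          also have "\<dots> = g v k" unfolding eq by (simp add: shift_def)
          finally show ?thesis .
        qed
        then have "g u = g v" by (rule ext)
        then have "f (g u) = f (g v)" by (rule arg_cong)
        then show "u = v" by (simp only: g_U(2)[OF u] g_U(2)[OF v])
      qed
      then show "inj_on T (topspace (top_of_set U))"

        by (simp only: topspace_euclidean_subtopology inj_on_cong[of U T "\<lambda>u. f (shift (g u))", OF T_eq])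
      show "Hausdorff_space (top_of_set U)" using Hausdorff_space_mtopology by (simp add: mtop)
    qed (use compact_U in \<open>simp add: compact_space_subtopology\<close>)
    then show ?thesis
      using compact_U by (simp add: top_dyn_system_def mtop Metric_space_axioms compact_space_subtopology)
  qed

  have iter: "(shift ^^ k) x \<in> X \<and> (T ^^ k) (f x) = f ((shift ^^ k) x)" if "x \<in> X" for k x
    using that by (induction k) (simp_all add: T_f shift_in)
  \<comment> \<open>The constant \<open>C\<close> bounds the diameter of \<open>U\<close> and hence
    the cost of a single bad time.\<close>
  obtain C where "C > 0" and C: "\<And>u v. u \<in> U \<Longrightarrow> v \<in> U \<Longrightarrow> d u v \<le> C"
    using compactin_imp_mbounded[of U] compact_U unfolding mbounded_alt_pos
    by (auto simp: mtop compactin_subtopology)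

  have main: "\<exists>\<delta>>0. \<forall>u\<in>U. \<forall>v\<in>U. d u v \<le> \<delta> \<longrightarrow>
      limsup (\<lambda>n. ereal ((1 / real n) * (\<Sum>k<n. d ((T ^^ k) u) ((T ^^ k) v)))) \<le> ereal \<epsilon>"
    if "\<epsilon> > 0" for \<epsilon>
  proof -
    obtain J where "finite J"
      and J: "\<And>x y. x \<in> X \<Longrightarrow> y \<in> X \<Longrightarrow> \<forall>j\<in>J. x j = y j \<Longrightarrow> d (f x) (f y) < \<epsilon> / 2"
    proof (rule uniformly_continuous_finite_dependence[OF Metric_space_axioms compact_X, of f "\<epsilon> / 2"])
      show "continuous_map (top_of_set X) mtopology f"
        unfolding mtop using cont_f by (simp add: U_eq)
    qed (use \<open>\<epsilon> > 0\<close> in auto)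
    \<comment> \<open>For \<open>n \<ge> p\<close> at most a fraction \<open>4 * card J / p\<close>
      of the first \<open>n\<close> times will be bad. As \<open>p > N\<close>, this choice keeps
      their share of the average below \<open>\<epsilon> / 2\<close>.\<close>
    obtain N :: nat where N: "8 * C * real (card J) / \<epsilon> < real N"
      using reals_Archimedean2 by blast
    obtain p where "p > int N" and p: "\<And>x. x \<in> X \<Longrightarrow> \<exists>h. constant_off_class p h x"
      using shifted_subshift_constant_off_class[of N q a] unfolding X_def by blast
    then have "p > 0" by simp
    have "\<exists>\<delta>>0. \<forall>u\<in>U. \<forall>v\<in>U. d u v < \<delta> \<longrightarrow> g u i = g v i" for i
    proof -
      have "continuous_map mtopology euclidean (\<lambda>u. g u i)"
        using continuous_on_product_then_coordinatewise[OF cont_g] by (simp add: mtop)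
      then show ?thesis
        using uniformly_locally_constant[OF Metric_space_axioms, of "\<lambda>u. g u i"] compact_U
        by (metis mtop compact_space_subtopology compactin_euclidean_iff)
    qed
    then obtain \<Delta> where \<Delta>: "\<And>i. \<Delta> i > 0" "\<And>i u v. u \<in> U \<Longrightarrow> v \<in> U \<Longrightarrow> d u v < \<Delta> i \<Longrightarrow> g u i = g v i"
      by metis
    \<comment> \<open>Halving the minimum turns the hypothesis \<open>d u v \<le> \<delta>\<close>
      into the strict inequality required by each \<open>\<Delta> i\<close>, so the decoded
      sequences agree on a full period.\<close>
    define \<delta> where "\<delta> = Min (\<Delta> ` {0..<p}) / 2"
    have Min_pos: "Min (\<Delta> ` {0..<p}) > 0" using \<Delta>(1) \<open>p > 0\<close> by (subst Min_gr_iff) auto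
    have \<delta>_less: "\<delta> < \<Delta> i" if "i \<in> {0..<p}" for i
    proof -
      have "Min (\<Delta> ` {0..<p}) \<le> \<Delta> i" using that by (intro Min_le) auto
      with Min_pos show ?thesis by (simp add: \<delta>_def)
    qed
    show ?thesis
    proof (intro exI[of _ \<delta>] conjI ballI impI)
      show "\<delta> > 0" using Min_pos by (simp add: \<delta>_def)
      fix u v assume u: "u \<in> U" and v: "v \<in> U" and "d u v \<le> \<delta>"
      define x y where "x = g u" and "y = g v"
      have x: "x \<in> X" "f x = u" and y: "y \<in> X" "f y = v"
        using g_U u v by (auto simp: x_def y_def)
      have window: "x i = y i" if "0 \<le> i" "i < p" for i
        unfolding x_def y_def using \<delta>_less[of i] that \<open>d u v \<le> \<delta>\<close> by (intro \<Delta>(2)[OF u v]) auto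
      obtain h h' where h: "constant_off_class p h x" "constant_off_class p h' y"
        using p x(1) y(1) by blast
      \<comment> \<open>At a time outside \<open>B\<close>, no coordinate observed through
        \<open>J\<close> lies in the exceptional class of \<open>x\<close> or
        \<open>y\<close>.\<close>
      define B where "B = {k. \<exists>j\<in>J. (int k + j) mod p = h \<or> (int k + j) mod p = h'}"
      define D where "D k = d ((T ^^ k) u) ((T ^^ k) v)" for k
      have D_eq: "D k = d (f ((shift ^^ k) x)) (f ((shift ^^ k) y))" for k
        using iter[OF x(1), of k] iter[OF y(1), of k] by (simp add: D_def x(2) y(2))
      have D_le: "D k \<le> C" for k
        unfolding D_eq using iter[OF x(1), of k] iter[OF y(1), of k] by (intro C) (auto simp: U_eq)
      have good: "D k \<le> \<epsilon> / 2" if "k \<notin> B" for k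
      proof -
        have "(shift ^^ k) x j = (shift ^^ k) y j" if "j \<in> J" for j
          unfolding shift_funpow
          by (rule constant_off_class_agree[OF h \<open>p > 0\<close> window])
             (use \<open>k \<notin> B\<close> \<open>j \<in> J\<close> in \<open>auto simp: B_def add.commute\<close>)
        then show ?thesis
          unfolding D_eq using iter[OF x(1), of k] iter[OF y(1), of k] by (intro less_imp_le J) auto
      qed
      note card_B = card_residue_classes_le[OF \<open>finite J\<close> \<open>p > 0\<close>, of _ h h', folded B_def]
      have "(1 / real n) * (\<Sum>k<n. D k) \<le> \<epsilon>" if n: "n \<ge> nat p" for n
      proof -
        have "n > 0" and np: "real_of_int p \<le> real n" and "real_of_int p > 0" using n \<open>p > 0\<close> by auto
        \<comment> \<open>Since \<open>n \<ge> p\<close>, the rounding term \<open>1\<close> of each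
          class is at most \<open>n / p\<close>, which doubles the main term.\<close>
        have "real (card ({..<n} \<inter> B)) \<le> real (card J) * (2 * (real n / real_of_int p + real n / real_of_int p))"
          using np \<open>real_of_int p > 0\<close>
          by (intro order.trans[OF card_B[of n]] mult_left_mono add_left_mono) auto
        then have "real (card ({..<n} \<inter> B)) / real n \<le> 4 * real (card J) / real_of_int p"
          using \<open>n > 0\<close> \<open>real_of_int p > 0\<close> by (simp add: field_simps)
        then have "C * (real (card ({..<n} \<inter> B)) / real n) \<le> C * (4 * real (card J) / real_of_int p)"
          using \<open>C > 0\<close> by (intro mult_left_mono) auto
        also have "\<dots> \<le> \<epsilon> / 2"
        proof -
          have "8 * C * real (card J) / \<epsilon> \<le> real_of_int p" using N \<open>p > int N\<close> by linarith
          then have "8 * C * real (card J) \<le> \<epsilon> * real_of_int p"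
            using \<open>\<epsilon> > 0\<close> by (simp add: pos_divide_le_eq mult.commute)
          then have "8 * C * real (card J) / real_of_int p \<le> \<epsilon>"
            using \<open>real_of_int p > 0\<close> by (simp add: pos_divide_le_eq)
          then show ?thesis by simp
        qed
        finally have "C * (real (card ({..<n} \<inter> B)) / real n) \<le> \<epsilon> / 2" .
        moreover have "(1 / real n) * (\<Sum>k<n. D k) \<le> \<epsilon> / 2 + C * (real (card ({..<n} \<inter> B)) / real n)"
          using \<open>C > 0\<close> \<open>\<epsilon> > 0\<close> by (intro average_le_bad_set D_le good) auto
        ultimately show ?thesis by linarith
      qed
      then have "\<forall>\<^sub>F n in sequentially. ereal ((1 / real n) * (\<Sum>k<n. D k)) \<le> ereal \<epsilon>"
        by (intro eventually_sequentiallyI[of "nat p"]) simp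
      then show "limsup (\<lambda>n. ereal ((1 / real n) * (\<Sum>k<n. d ((T ^^ k) u) ((T ^^ k) v)))) \<le> ereal \<epsilon>"
        unfolding D_def by (rule Limsup_bounded)
    qed
  qed
  show ?thesis
    unfolding mean_equicontinuous_def U_def[symmetric] T_def[symmetric]
    by (intro conjI allI impI tds main)
qed

end
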